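(* Let $\mathscr{C} \in \mathbb{R}^{n\times n\times n_3}$ be T-symmetric positive definite, let $\mathscr{D} \in \mathbb{R}^{n\times l\times n_3}$, and let $\mathscr{X}_1 \in \mathbb{R}^{n\times l\times n_3}$ be an arbitrary initial tensor. Let $\{\mathscr{R}_k\}$ and $\{\mathscr{P}_k\}$ be the tensor sequences generated by Algorithm A (described in the context) from $\mathscr{C},\mathscr{D},\mathscr{X}_1$, and suppose $\mathscr{R}_1,\dots,\mathscr{R}_m$ are generated and nonzero. Then $\{\mathscr{R}_k\}_{k=1}^m$ is an orthogonal tensor sequence and $\{\mathscr{P}_k\}_{k=1}^m$ is a $\mathscr{C}$-orthogonal tensor sequence; that is, for all $s\neq t$ in $\{1,\dots,m\}$, $\langle \mathscr{R}_s,\mathscr{R}_t\rangle = 0$ and $\langle \mathscr{C}\star\mathscr{P}_s,\mathscr{P}_t\rangle=0$.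
   Context: Third-order tensors: for $\mathscr{A}\in\mathbb{R}^{m\times p\times q}$, $\mathscr{A}^{(k)}=\mathscr{A}(:,:,k)\in\mathbb{R}^{m\times p}$ denotes its $k$-th frontal slice, $k=1,\dots,q$. T-product: for $\mathscr{A}\in\mathbb{R}^{m\times p\times q}$, $\mathscr{B}\in\mathbb{R}^{p\times s\times q}$, $\mathscr{A}\star\mathscr{B}\in\mathbb{R}^{m\times s\times q}$ is defined by $(\mathscr{A}\star\mathscr{B})^{(k)}=\sum_{j=1}^{q}\mathscr{A}^{(k-j+1)}\mathscr{B}^{(j)}$, slice indices of $\mathscr{A}$ taken modulo $q$ in $\{1,\dots,q\}$ (block-circulant matrix of $\mathscr{A}$ times the stacked slices of $\mathscr{B}$). Transpose: $\mathscr{A}^T\in\mathbb{R}^{p\times m\times q}$ is obtained by transposing each frontal slice and reversing the order of the transposed slices $2,\dots,q$. Inner product: $\langle\mathscr{A},\mathscr{B}\rangle=\sum_{i,j,k}a_{ijk}b_{ijk}=Tr((\mathscr{B}^T\star\mathscr{A})^{(1)})$, where $Tr$ is the matrix trace. $\mathscr{O}$ is the zero tensor. T-symmetric positive definite: $\mathscr{C}\in\mathbb{R}^{n\times n\times n_3}$ with $\mathscr{C}^T=\mathscr{C}$ such that each matrix $\overline{C}^{(i)}=\sum_{k=1}^{n_3}\vartheta^{(i-1)(k-1)}\mathscr{C}^{(k)}$, $\vartheta=e^{-2\pi \mathrm{i}/n_3}$, $i=1,\dots,n_3$ (the $i$-th frontal slice of the discrete Fourier transform of $\mathscr{C}$ along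 the third dimension), is Hermitian positive definite. Orthogonal / $\mathscr{C}$-orthogonal tensor sequences: sequences of nonzero tensors $\mathscr{R}_k$, $\mathscr{P}_k$ with $\langle\mathscr{R}_s,\mathscr{R}_t\rangle=0$, respectively $\langle\mathscr{C}\star\mathscr{P}_s,\mathscr{P}_t\rangle=0$, for all $s\ne t$. Algorithm A (exact arithmetic) for $\mathscr{C}\star\mathscr{X}=\mathscr{D}$: set $\mathscr{R}_1=\mathscr{D}-\mathscr{C}\star\mathscr{X}_1$, $\mathscr{P}_1=\mathscr{R}_1$. For $k=2,3,\dots$, as long as $\mathscr{R}_{k-1}\neq\mathscr{O}$ (otherwise stop), set $$\mathscr{X}_k=\mathscr{X}_{k-1}+\frac{Tr((\mathscr{P}_{k-1}^T\star\mathscr{R}_{k-1})^{(1)})}{Tr((\mathscr{P}_{k-1}^T\star\mathscr{C}\star\mathscr{P}_{k-1})^{(1)})}\mathscr{P}_{k-1},\quad \mathscr{R}_k=\mathscr{D}-\mathscr{C}\star\mathscr{X}_k,$$ $$\mathscr{P}_k=\mathscr{R}_k-\frac{Tr((\mathscr{P}_{k-1}^T\star\mathscr{C}\star\mathscr{R}_k)^{(1)})}{Tr((\mathscr{P}_{k-1}^T\star\mathscr{C}\star\mathscr{P}_{k-1})^{(1)})}\mathscr{P}_{k-1}.$$ *)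

theory Defs
  imports "HOL-Analysis.Analysis"
begin

text \<open>
  An \<open>m \<times> p \<times> q\<close> real tensor is an element of \<^typ>\<open>real^'p^'m^'q\<close>: the outermost index selects a
  frontal slice, which is an ordinary \<open>m \<times> p\<close> matrix. The vector space operations, the zero tensor
  and the inner product (sum of the products of all entries) are those of this library type.
  Since the T-product depends on the cyclic order of the slices, the index type \<^typ>\<open>'q\<close> is
  numbered \<open>1, \<dots>, CARD('q)\<close> by a fixed bijection. Slice numbers are integers and are
  read modulo \<open>CARD('q)\<close>.
\<close>

definition slice_no :: "'q::finite \<Rightarrow> int"
  where "slice_no k = int (to_nat_on (UNIV :: 'q set) k) + 1"

definition slice_index :: "int \<Rightarrow> 'q::finite"
  where "slice_index k = from_nat_into (UNIV :: 'q set) (nat ((k - 1) mod int CARD('q)))"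

definition frontal :: "real^'p^'m^'q::finite \<Rightarrow> int \<Rightarrow> real^'p^'m"
  where "frontal A k = A $ slice_index k"

lemma slice_no_bounds: "1 \<le> slice_no (k :: 'q::finite)" "slice_no k \<le> int CARD('q)"
proof -
  have "to_nat_on (UNIV :: 'q set) k \<in> {..<CARD('q)}"
    using to_nat_on_finite[OF finite, of "UNIV :: 'q set"] by (rule bij_betwE[rule_format]) simp
  then show "1 \<le> slice_no k" "slice_no k \<le> int CARD('q)"
    by (simp_all add: slice_no_def)
qed

lemma slice_index_slice_no [simp]: "slice_index (slice_no k) = k"
  using slice_no_bounds[of k]
  by (simp add: slice_index_def slice_no_def countable_finite)

lemma slice_no_slice_index:
  assumes "1 \<le> k" "k \<le> int CARD('q::finite)"
  shows "slice_no (slice_index k :: 'q) = k"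
proof -
  have "nat (k - 1) \<in> to_nat_on (UNIV :: 'q set) ` UNIV"
    using to_nat_on_finite[OF finite, of "UNIV :: 'q set"] assms
    by (simp add: bij_betw_def)
  then have "to_nat_on (UNIV :: 'q set) (from_nat_into UNIV (nat (k - 1))) = nat (k - 1)"
    by (rule to_nat_on_from_nat_into)
  then show ?thesis
    using assms by (simp add: slice_no_def slice_index_def)
qed

definition t_prod :: "real^'p^'m^'q::finite \<Rightarrow> real^'s^'p^'q \<Rightarrow> real^'s^'m^'q" (infixl "\<star>" 70)
  where "A \<star> B = (\<chi> k. \<Sum>j = 1..int CARD('q). frontal A (slice_no k - j + 1) ** frontal B j)"

lemma frontal_t_prod:
  fixes A :: "real^'p^'m^'q::finite" and B :: "real^'s^'p^'q"
  assumes "1 \<le> k" "k \<le> int CARD('q)"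
  shows "frontal (A \<star> B) k = (\<Sum>j = 1..int CARD('q). frontal A (k - j + 1) ** frontal B j)"
  using slice_no_slice_index[OF assms] by (simp add: t_prod_def frontal_def)

definition t_transpose :: "real^'p^'m^'q::finite \<Rightarrow> real^'m^'p^'q"
  where "t_transpose A = (\<chi> k. transpose (frontal A
    (if slice_no k = 1 then 1 else int CARD('q) + 2 - slice_no k)))"

lemma frontal_t_transpose:
  fixes A :: "real^'p^'m^'q::finite"
  assumes "1 \<le> k" "k \<le> int CARD('q)"
  shows "frontal (t_transpose A) k =
    transpose (frontal A (if k = 1 then 1 else int CARD('q) + 2 - k))"
  using slice_no_slice_index[OF assms] by (simp add: t_transpose_def frontal_def)

definition hermitian :: "complex^'n^'n \<Rightarrow> bool"
  where "hermitian M \<longleftrightarrow> (\<forall>i j. M $ i $ j = cnj (M $ j $ i))"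

text \<open>For Hermitian \<open>M\<close> the form \<open>x\<^sup>H M x\<close> is real, so taking its real part loses nothing.\<close>

definition hermitian_pos_def :: "complex^'n^'n \<Rightarrow> bool"
  where "hermitian_pos_def M \<longleftrightarrow> hermitian M \<and>
    (\<forall>x. x \<noteq> 0 \<longrightarrow> 0 < Re (\<Sum>i\<in>UNIV. cnj (x $ i) * (M *v x) $ i))"

definition dft_slice :: "real^'p^'m^'q::finite \<Rightarrow> nat \<Rightarrow> complex^'p^'m"
  where "dft_slice A i = (\<chi> a b. \<Sum>k = 1..CARD('q).
    exp (- (2 * complex_of_real pi * \<i>) / of_nat CARD('q)) ^ ((i - 1) * (k - 1)) *
    complex_of_real (frontal A (int k) $ a $ b))"

definition t_sym_pos_def :: "real^'n^'n^'q::finite \<Rightarrow> bool"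
  where "t_sym_pos_def C \<longleftrightarrow> t_transpose C = C \<and>
    (\<forall>i \<in> {1..CARD('q)}. hermitian_pos_def (dft_slice C i))"

definition trace1 :: "real^'n^'n^'q::finite \<Rightarrow> real"
  where "trace1 A = trace (frontal A 1)"

text \<open>
  \<open>algorithm_A C D X1 m X R P\<close>: started at \<open>X1\<close>, the algorithm reaches index \<open>m\<close>, that is, it does
  not stop earlier because of a zero residual, and it produces \<open>X k\<close>, \<open>R k\<close>, \<open>P k\<close> for
  \<open>1 \<le> k \<le> m\<close>. Values of the sequences at other indices are irrelevant.
\<close>

definition algorithm_A ::
  "real^'n^'n^'q::finite \<Rightarrow> real^'l^'n^'q \<Rightarrow> real^'l^'n^'q \<Rightarrow> nat \<Rightarrow>
   (nat \<Rightarrow> real^'l^'n^'q) \<Rightarrow> (nat \<Rightarrow> real^'l^'n^'q) \<Rightarrow> (nat \<Rightarrow> real^'l^'n^'q) \<Rightarrow> bool"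
  where "algorithm_A C D X1 m X R P \<longleftrightarrow>
    X 1 = X1 \<and> R 1 = D - C \<star> X 1 \<and> P 1 = R 1 \<and>
    (\<forall>k \<in> {2..m}.
       R (k - 1) \<noteq> 0 \<and>
       X k = X (k - 1) +
         (trace1 (t_transpose (P (k - 1)) \<star> R (k - 1)) /
          trace1 (t_transpose (P (k - 1)) \<star> C \<star> P (k - 1))) *\<^sub>R P (k - 1) \<and>
       R k = D - C \<star> X k \<and>
       P k = R k -
         (trace1 (t_transpose (P (k - 1)) \<star> C \<star> R k) /
          trace1 (t_transpose (P (k - 1)) \<star> C \<star> P (k - 1))) *\<^sub>R P (k - 1))"

definition orthogonal_tensors :: "nat \<Rightarrow> (nat \<Rightarrow> real^'l^'n^'q::finite) \<Rightarrow> bool"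
  where "orthogonal_tensors m R \<longleftrightarrow> (\<forall>k \<in> {1..m}. R k \<noteq> 0) \<and>
    (\<forall>s \<in> {1..m}. \<forall>t \<in> {1..m}. s \<noteq> t \<longrightarrow> R s \<bullet> R t = 0)"

definition C_orthogonal_tensors ::
  "real^'n^'n^'q::finite \<Rightarrow> nat \<Rightarrow> (nat \<Rightarrow> real^'l^'n^'q) \<Rightarrow> bool"
  where "C_orthogonal_tensors C m P \<longleftrightarrow> (\<forall>k \<in> {1..m}. P k \<noteq> 0) \<and>
    (\<forall>s \<in> {1..m}. \<forall>t \<in> {1..m}. s \<noteq> t \<longrightarrow> (C \<star> P s) \<bullet> P t = 0)"

end

theory Submission imports Defs begin

text \<open>
  The operator \<open>C \<star> _\<close> is self-adjoint because \<open>C\<close> is its own transpose. The Fourier transform turns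
  the T-product into slicewise matrix products and, by Parseval, preserves the inner product up to
  the factor \<open>CARD('q)\<close>, so \<open>P \<bullet> (C \<star> P)\<close> is a positive combination of the Hermitian forms of the
  transformed slices of \<open>C\<close>. Since the traces in the algorithm are inner products, the algorithm is
  the conjugate gradient method for a positive definite self-adjoint operator, and the usual
  induction applies.
\<close>

section \<open>Slices as periodic sequences\<close>

text \<open>The map sending \<open>k\<close> to \<open>(k + c - 1) mod q + 1\<close> permutes
  \<open>{1..q}\<close>, and periodicity hides the reduction. Both cyclic reindexings below, for the
  transpose and for the transform of a product, rest on it.\<close>

lemma sum_periodic_shift:
  fixes f :: "int \<Rightarrow> 'a::comm_monoid_add" and q c :: int
  assumes "q > 0" and "\<And>k. f (k mod q) = f k"
  shows "(\<Sum>k = 1..q. f (k + c)) = (\<Sum>k = 1..q. f k)"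
proof (rule sum.reindex_bij_witness[where i = "\<lambda>k. (k - c - 1) mod q + 1"
      and j = "\<lambda>k. (k + c - 1) mod q + 1"])
  fix k assume k: "k \<in> {1..q}"
  then have *: "(k - 1) mod q + 1 = k"
    by simp
  have "((k + c - 1) mod q + 1 - c - 1) mod q = ((k + c - 1) mod q - c) mod q"
    by (simp add: algebra_simps)
  also have "\<dots> = (k - 1) mod q"
    by (simp add: mod_diff_left_eq)
  finally show "((k + c - 1) mod q + 1 - c - 1) mod q + 1 = k"
    using * by simp
  have "((k - c - 1) mod q + 1 + c - 1) mod q = ((k - c - 1) mod q + c) mod q"
    by (simp add: algebra_simps)
  also have "\<dots> = (k - 1) mod q"
    by (simp add: mod_add_left_eq)
  finally show "((k - c - 1) mod q + 1 + c - 1) mod q + 1 = k"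
    using * by simp
  show "(k + c - 1) mod q + 1 \<in> {1..q}" "(k - c - 1) mod q + 1 \<in> {1..q}"
    using \<open>q > 0\<close> pos_mod_bound[of q] by (simp_all add: add1_zle_eq)
  have "((k + c - 1) mod q + 1) mod q = (k + c) mod q"
    by (simp add: mod_add_left_eq)
  then show "f ((k + c - 1) mod q + 1) = f (k + c)"
    using assms(2) by metis
qed

lemma slice_index_cong:
  assumes "j mod int CARD('q) = k mod int CARD('q)"
  shows "slice_index j = (slice_index k :: 'q::finite)"
  using mod_diff_cong[OF assms refl[of "1 mod int CARD('q)"]] by (simp add: slice_index_def)

lemma slice_no_slice_index_cong:
  "slice_no (slice_index k :: 'q::finite) mod int CARD('q) = k mod int CARD('q)"
proof -
  \<comment> \<open>\<open>r\<close> represents \<open>k\<close> modulo \<open>CARD('q)\<close>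
    within the range where \<open>slice_no_slice_index\<close> applies.\<close>
  define r where "r = (k - 1) mod int CARD('q) + 1"
  have r: "1 \<le> r" "r \<le> int CARD('q)"
    using pos_mod_bound[of "int CARD('q)"] by (simp_all add: r_def add1_zle_eq)
  have rk: "r mod int CARD('q) = k mod int CARD('q)"
    by (simp add: r_def mod_add_left_eq)
  show ?thesis
    using slice_no_slice_index[OF r] slice_index_cong[OF rk] rk by simp
qed

lemma frontal_cong:
  fixes A :: "real^'p^'m^'q::finite"
  assumes "j mod int CARD('q) = k mod int CARD('q)"
  shows "frontal A j = frontal A k"
  using slice_index_cong[OF assms] by (simp add: frontal_def)

lemma frontal_mod: "frontal A (k mod int CARD('q)) = frontal (A :: real^'p^'m^'q::finite) k"
  by (rule frontal_cong) simp

lemma frontal_diff_mod: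
  "frontal A (c - k mod int CARD('q)) = frontal (A :: real^'p^'m^'q::finite) (c - k)"
  by (rule frontal_cong) (simp add: mod_diff_right_eq)

text \<open>Since slices are periodic in their number, the convolution formula extends to all
  integers \<open>k\<close>, which frees later index arithmetic from range conditions.\<close>

lemma frontal_t_prod_int:
  fixes A :: "real^'p^'m^'q::finite" and B :: "real^'s^'p^'q"
  shows "frontal (A \<star> B) k = (\<Sum>j = 1..int CARD('q). frontal A (k - j + 1) ** frontal B j)"
proof -
  have "frontal A (slice_no (slice_index k :: 'q) - j + 1) = frontal A (k - j + 1)" for j
    by (intro frontal_cong mod_add_cong mod_diff_cong slice_no_slice_index_cong refl)
  then show ?thesis
    by (simp add: t_prod_def frontal_def[of "vec_lambda _"])
qed

text \<open>Modulo \<open>CARD('q)\<close> both branches of the definition are \<open>2 - k\<close>,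
  so transposition reflects the slice numbers without a special case for slice 1.\<close>

lemma frontal_t_transpose_int:
  fixes A :: "real^'p^'m^'q::finite"
  shows "frontal (t_transpose A) k = transpose (frontal A (2 - k))"
proof -
  let ?n = "slice_no (slice_index k :: 'q)"
  have "(if ?n = 1 then 1 else int CARD('q) + 2 - ?n) mod int CARD('q) = (2 - ?n) mod int CARD('q)"
    by (auto simp: add_diff_eq[symmetric])
  also have "\<dots> = (2 - k) mod int CARD('q)"
    by (intro mod_diff_cong slice_no_slice_index_cong refl)
  finally have "frontal A (if ?n = 1 then 1 else int CARD('q) + 2 - ?n) = frontal A (2 - k)"
    by (rule frontal_cong)
  then show ?thesis
    by (simp add: t_transpose_def frontal_def[of "vec_lambda _"])
qed

lemma sum_slice_index:
  fixes f :: "'q::finite \<Rightarrow> 'a::comm_monoid_add"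
  shows "(\<Sum>x\<in>UNIV. f x) = (\<Sum>k = 1..int CARD('q). f (slice_index k))"
  by (rule sum.reindex_bij_witness[where i = slice_index and j = slice_no])
    (auto simp: slice_no_bounds slice_no_slice_index)

lemma inner_tensor_frontal:
  fixes A B :: "real^'p^'m^'q::finite"
  shows "A \<bullet> B = (\<Sum>k = 1..int CARD('q). frontal A k \<bullet> frontal B k)"
  by (simp add: inner_vec_def[of A B] sum_slice_index frontal_def)

lemma tensor_eqI:
  fixes A B :: "real^'p^'m^'q::finite"
  assumes "\<And>k. frontal A k = frontal B k"
  shows "A = B"
  by (metis assms frontal_def slice_index_slice_no vec_eq_iff)

section \<open>Algebra of the T-product\<close>

lemma trace_transpose_mul:
  fixes A B :: "real^'n^'m"
  shows "trace (transpose A ** B) = A \<bullet> B"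
  unfolding trace_def matrix_matrix_mult_def transpose_def inner_vec_def
  by (simp, subst sum.swap, simp)

lemma inner_matrix_mul:
  fixes A :: "real^'p^'m"
  shows "(A ** B) \<bullet> M = B \<bullet> (transpose A ** M)"
  by (simp add: trace_transpose_mul[symmetric] matrix_transpose_mul matrix_mul_assoc)

lemma transpose_sum: "transpose (\<Sum>i\<in>I. A i) = (\<Sum>i\<in>I. transpose (A i))"
  by (simp add: vec_eq_iff transpose_def)

lemma trace_sum: "trace (\<Sum>i\<in>I. A i) = (\<Sum>i\<in>I. trace (A i))"
  unfolding trace_def by (simp, rule sum.swap)

text \<open>Slice \<open>2 - j\<close> of \<open>t_transpose A\<close> is the transpose of slice
  \<open>j\<close> of \<open>A\<close>, so slice 1 of the product pairs equal slice numbers.\<close>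

lemma trace1_t_transpose_t_prod: "trace1 (t_transpose A \<star> B) = A \<bullet> B"
  by (simp add: trace1_def frontal_t_prod_int frontal_t_transpose_int trace_sum
      trace_transpose_mul inner_tensor_frontal)

lemma t_transpose_t_transpose [simp]: "t_transpose (t_transpose A) = A"
  by (rule tensor_eqI) (simp add: frontal_t_transpose_int)

lemma t_transpose_t_prod: "t_transpose (A \<star> B) = t_transpose B \<star> t_transpose A"
  for A :: "real^'p^'m^'q::finite" and B :: "real^'s^'p^'q"
proof (rule tensor_eqI)
  fix k
  let ?q = "int CARD('q)"
  define f where "f r = transpose (frontal B r) ** transpose (frontal A (3 - k - r))" for r
  have "frontal (t_transpose (A \<star> B)) k = (\<Sum>r = 1..?q. f r)"
    by (simp add: frontal_t_prod_int frontal_t_transpose_int transpose_sum matrix_transpose_mul f_def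
        algebra_simps)
  \<comment> \<open>The two convolutions have the same periodic summand, read with an offset of
    \<open>1 - k\<close>.\<close>
  also have "\<dots> = (\<Sum>r = 1..?q. f (r + (1 - k)))"
    by (rule sum_periodic_shift[symmetric]) (simp_all add: f_def frontal_mod frontal_diff_mod)
  also have "\<dots> = frontal (t_transpose B \<star> t_transpose A) k"
    by (simp add: frontal_t_prod_int frontal_t_transpose_int f_def algebra_simps)
  finally show "frontal (t_transpose (A \<star> B)) k = frontal (t_transpose B \<star> t_transpose A) k" .
qed

text \<open>Each block moves across as a matrix adjoint, and the transpose of slice
  \<open>k - r + 1\<close> of \<open>A\<close> is slice \<open>r - k + 1\<close> of
  \<open>t_transpose A\<close>.\<close>

lemma inner_t_prod: "(A \<star> B) \<bullet> M = B \<bullet> (t_transpose A \<star> M)"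
  for A :: "real^'p^'m^'q::finite" and B :: "real^'s^'p^'q"
proof -
  let ?q = "int CARD('q)"
  have "(A \<star> B) \<bullet> M = (\<Sum>k = 1..?q. \<Sum>r = 1..?q. (frontal A (k - r + 1) ** frontal B r) \<bullet> frontal M k)"
    by (simp add: inner_tensor_frontal frontal_t_prod_int inner_sum_left)
  also have "\<dots> = (\<Sum>r = 1..?q. \<Sum>k = 1..?q. (frontal A (k - r + 1) ** frontal B r) \<bullet> frontal M k)"
    by (rule sum.swap)
  also have "\<dots> = B \<bullet> (t_transpose A \<star> M)"
    by (simp add: inner_tensor_frontal frontal_t_prod_int frontal_t_transpose_int inner_sum_right
        inner_matrix_mul algebra_simps)
  finally show ?thesis .
qed

lemma linear_t_prod:
  fixes A :: "real^'p^'m^'q::finite"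
  shows "linear ((\<star>) A :: real^'s^'p^'q \<Rightarrow> _)"
proof (rule linearI)
  fix B M :: "real^'s^'p^'q" and c :: real
  have scale: "U ** (c *\<^sub>R V) = c *\<^sub>R (U ** V)" for U :: "real^'p^'m" and V :: "real^'s^'p"
    by (simp add: vec_eq_iff matrix_matrix_mult_def sum_distrib_left mult_ac)
  have "frontal (B + M) k = frontal B k + frontal M k" "frontal (c *\<^sub>R B) k = c *\<^sub>R frontal B k" for k
    by (simp_all add: frontal_def)
  then show "A \<star> (B + M) = A \<star> B + A \<star> M" "A \<star> (c *\<^sub>R B) = c *\<^sub>R (A \<star> B)"
    unfolding t_prod_def
    by (simp_all add: vec_eq_iff[where 'b = 'q] matrix_add_ldistrib scale sum.distrib scaleR_sum_right)
qed

section \<open>Discrete Fourier transform and positivity\<close>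

text \<open>The transform is evaluated at an arbitrary point \<open>z\<close>; \<^const>\<open>dft_slice\<close> is the case in which
  \<open>z\<close> is a power of the primitive root of unity.\<close>

definition slice_transform :: "complex \<Rightarrow> real^'p^'m^'q::finite \<Rightarrow> complex^'p^'m"
  where "slice_transform z A = (\<chi> a b. \<Sum>k = 1..int CARD('q).
    z powi (k - 1) * complex_of_real (frontal A k $ a $ b))"

text \<open>A primitive root of unity whose order is carried by the type, hence the
  \<open>itself\<close> argument.\<close>

definition root1 :: "'q::finite itself \<Rightarrow> complex"
  where "root1 _ = exp (- (2 * complex_of_real pi * \<i>) / of_nat CARD('q))"

lemma dft_slice_eq_slice_transform:
  fixes A :: "real^'p^'m^'q::finite"
  shows "dft_slice A i = slice_transform (root1 TYPE('q) ^ (i - 1)) A"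
proof -
  have "(\<Sum>k = 1..CARD('q). root1 TYPE('q) ^ ((i - 1) * (k - 1)) *
      complex_of_real (frontal A (int k) $ a $ b)) =
    (\<Sum>k = 1..int CARD('q). (root1 TYPE('q) ^ (i - 1)) powi (k - 1) *
      complex_of_real (frontal A k $ a $ b))" for a b
    by (rule sum.reindex_bij_witness[where i = nat and j = int])
      (auto simp: power_int_def power_mult nat_diff_distrib)
  then show ?thesis
    by (simp add: dft_slice_def slice_transform_def root1_def)
qed

lemma power_int_mod_root_of_unity:
  fixes z :: "'a::field"
  assumes "z ^ q = 1"
  shows "z powi (k mod int q) = z powi k"
\<comment> \<open>For \<open>q = 0\<close> the claim is trivial because \<open>k mod 0 = k\<close>;
  otherwise \<open>z\<close> is nonzero and the exponent laws apply.\<close>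
proof (cases "q = 0")
  case False
  then have "z \<noteq> 0"
    using assms by (metis power_eq_0_iff zero_neq_one zero_power2 gr0I zero_power)
  have "z powi k = z powi (int q * (k div int q) + k mod int q)"
    by simp
  also have "\<dots> = (z powi int q) powi (k div int q) * z powi (k mod int q)"
    using \<open>z \<noteq> 0\<close> by (simp only: power_int_add power_int_mult simp_thms)
  also have "\<dots> = z powi (k mod int q)"
    by (simp add: assms)
  finally show ?thesis ..
qed simp

text \<open>Convolution theorem: the weight splits as
  \<open>z powi (k - r) * z powi (r - 1)\<close>, and for fixed \<open>r\<close> the sum over
  \<open>k\<close> runs through a full period of \<open>A\<close>.\<close>

lemma slice_transform_t_prod:
  fixes A :: "real^'p^'m^'q::finite" and B :: "real^'s^'p^'q"
  assumes "z ^ CARD('q) = 1"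
  shows "slice_transform z (A \<star> B) = slice_transform z A ** slice_transform z B"
proof -
  let ?q = "int CARD('q)"
  have "z \<noteq> 0"
    using assms by (auto simp: power_0_left)
  have "slice_transform z (A \<star> B) $ a $ b = (slice_transform z A ** slice_transform z B) $ a $ b"
    for a b
  proof -
    define x where "x k p = complex_of_real (frontal A k $ a $ p)" for k p
    define y where "y k p = complex_of_real (frontal B k $ p $ b)" for k p
    have shift: "(\<Sum>k = 1..?q. z powi (k - r) * x (k - r + 1) p) =
        (\<Sum>k = 1..?q. z powi (k - 1) * x k p)" for r p
    proof -
      define g where "g k = z powi (k - 1) * x k p" for k
      have "z powi (k mod ?q - 1) = z powi (k - 1)" for k
        by (metis assms mod_diff_left_eq power_int_mod_root_of_unity)
      then have "(\<Sum>k = 1..?q. g (k + (1 - r))) = (\<Sum>k = 1..?q. g k)"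
        by (intro sum_periodic_shift) (simp_all add: g_def x_def frontal_mod)
      then show ?thesis
        by (simp add: g_def algebra_simps)
    qed
    have "slice_transform z (A \<star> B) $ a $ b =
        (\<Sum>k = 1..?q. \<Sum>r = 1..?q. \<Sum>p\<in>UNIV. z powi (k - 1) * (x (k - r + 1) p * y r p))"
      by (simp add: slice_transform_def frontal_t_prod_int matrix_matrix_mult_def x_def y_def
          sum_distrib_left)
    also have "\<dots> = (\<Sum>r = 1..?q. \<Sum>k = 1..?q. \<Sum>p\<in>UNIV. z powi (k - 1) * (x (k - r + 1) p * y r p))"
      by (rule sum.swap)
    also have "\<dots> = (\<Sum>r = 1..?q. \<Sum>p\<in>UNIV. \<Sum>k = 1..?q. z powi (k - 1) * (x (k - r + 1) p * y r p))"
      by (intro sum.cong refl sum.swap)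
    also have "\<dots> = (\<Sum>r = 1..?q. \<Sum>p\<in>UNIV.
        (\<Sum>k = 1..?q. z powi (k - r) * x (k - r + 1) p) * (z powi (r - 1) * y r p))"
    proof -
      have "z powi (k - 1) = z powi (k - r) * z powi (r - 1)" for k r
        using \<open>z \<noteq> 0\<close> by (simp flip: power_int_add)
      then have "z powi (k - 1) * (x (k - r + 1) p * y r p) =
          z powi (k - r) * x (k - r + 1) p * (z powi (r - 1) * y r p)" for k r p
        by (metis mult.assoc mult.left_commute)
      then show ?thesis
        by (simp only: sum_distrib_right)
    qed
    also have "\<dots> = (\<Sum>r = 1..?q. \<Sum>p\<in>UNIV.
        (\<Sum>k = 1..?q. z powi (k - 1) * x k p) * (z powi (r - 1) * y r p))"
      by (simp only: shift)
    also have "\<dots> = (\<Sum>p\<in>UNIV. \<Sum>r = 1..?q.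
        (\<Sum>k = 1..?q. z powi (k - 1) * x k p) * (z powi (r - 1) * y r p))"
      by (rule sum.swap)
    also have "\<dots> = (slice_transform z A ** slice_transform z B) $ a $ b"
      by (simp add: slice_transform_def matrix_matrix_mult_def x_def y_def sum_distrib_left)
    finally show ?thesis .
  qed
  then show ?thesis
    by (simp add: vec_eq_iff)
qed

section \<open>Roots of unity and Parseval's identity\<close>

lemma root1_powi:
  "root1 TYPE('q::finite) powi n = exp (- (2 * complex_of_real pi * \<i>) * of_int n / of_nat CARD('q))"
  by (simp add: root1_def exp_power_int mult_ac)

lemma root1_power_CARD: "root1 TYPE('q::finite) ^ CARD('q) = 1"
  using root1_powi[of "int CARD('q)", where 'q = 'q] by (simp add: exp_minus)

text \<open>Primitivity: a power equal to 1 forces \<open>CARD('q)\<close> to divide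
  \<open>n\<close>, impossible for nonzero \<open>n\<close> of smaller absolute value.\<close>

lemma root1_powi_neq_1:
  assumes "n \<noteq> 0" "\<bar>n\<bar> < int CARD('q::finite)"
  shows "root1 TYPE('q) powi n \<noteq> 1"
proof
  assume "root1 TYPE('q) powi n = 1"
  then obtain j :: int where j: "- (2 * pi * of_int n / of_nat CARD('q)) = of_int (2 * j) * pi"
    unfolding root1_powi exp_eq_1 by auto
  then have "pi * (- real_of_int n) = pi * (of_int j * of_nat CARD('q))"
    by (simp add: field_simps)
  then have "- real_of_int n = of_int j * of_nat CARD('q)"
    unfolding mult_cancel_left by simp
  then have "- n = j * int CARD('q)"
    by (metis of_int_eq_iff of_int_minus of_int_mult of_int_of_nat_eq)
  then have "int CARD('q) dvd n"
    by (metis dvd_minus_iff dvd_triv_right)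
  then show False
    using assms zdvd_imp_le[of "int CARD('q)" "\<bar>n\<bar>"] by simp
qed

text \<open>Orthogonality of characters: off the diagonal this is a geometric sum whose ratio
  differs from 1 but has \<open>CARD('q)\<close>-th power 1.\<close>

lemma sum_root1_powers:
  assumes "k \<in> {1..int CARD('q)}" "l \<in> {1..int CARD('q)}"
  shows "(\<Sum>i<CARD('q::finite). (root1 TYPE('q) powi (l - k)) ^ i) =
    (if k = l then of_nat CARD('q) else 0)"
proof (cases "k = l")
  case False
  let ?u = "root1 TYPE('q) powi (l - k)"
  have "?u \<noteq> 1"
    using False assms by (intro root1_powi_neq_1) auto
  moreover have "?u ^ CARD('q) = 1"
    by (metis power_int_1_left power_int_commutes power_int_mult power_int_of_nat root1_power_CARD
        mult.commute)
  ultimately show ?thesis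
    using False by (simp add: geometric_sum)
qed simp

lemma cnj_power_int_norm_1:
  assumes "norm z = 1"
  shows "cnj (z powi n) = z powi (- n)"
proof -
  have "cnj z = inverse z"
    using assms by (simp add: inverse_complex_def complex_eq_iff cmod_def)
  then show ?thesis
    by (simp add: power_int_minus power_int_inverse)
qed

text \<open>Expanding both transforms gives a double sum over slices \<open>k\<close>,
  \<open>l\<close>; summing over the frequency \<open>i\<close> first leaves only
  \<open>k = l\<close>. The factor \<open>CARD('q)\<close> reflects the unnormalised
  transform.\<close>

lemma parseval_slice_transform:
  fixes A B :: "real^'p^'m^'q::finite"
  defines "z \<equiv> \<lambda>i. root1 TYPE('q) ^ i"
  shows "(\<Sum>i<CARD('q). \<Sum>a\<in>UNIV. \<Sum>b\<in>UNIV.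
      cnj (slice_transform (z i) A $ a $ b) * slice_transform (z i) B $ a $ b) =
    of_real (CARD('q) * (A \<bullet> B))"
proof -
  let ?q = "int CARD('q)"
  have norm_z: "norm (z i) = 1" for i
    by (simp add: z_def root1_def norm_power)
  have entry: "(\<Sum>i<CARD('q). cnj (slice_transform (z i) A $ a $ b) * slice_transform (z i) B $ a $ b) =
      of_real (CARD('q) * (\<Sum>k = 1..?q. frontal A k $ a $ b * frontal B k $ a $ b))" for a b
  proof -
    define x where "x k = frontal A k $ a $ b" for k
    define y where "y k = frontal B k $ a $ b" for k
    \<comment> \<open>Conjugation inverts numbers of modulus 1, so the weights merge into the
      \<open>i\<close>-th power of one root, as \<open>sum_root1_powers\<close> expects.\<close>
    have zz: "cnj (z i powi (k - 1)) * z i powi (l - 1) = (root1 TYPE('q) powi (l - k)) ^ i" for i k l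
    proof -
      have "z i \<noteq> 0"
        using norm_z[of i] by auto
      have "cnj (z i powi (k - 1)) * z i powi (l - 1) = z i powi (l - k)"
        unfolding cnj_power_int_norm_1[OF norm_z] using \<open>z i \<noteq> 0\<close>
        by (simp flip: power_int_add)
      also have "\<dots> = (root1 TYPE('q) powi (l - k)) ^ i"
        unfolding z_def by (metis mult.commute power_int_mult power_int_of_nat)
      finally show ?thesis .
    qed
    have "(\<Sum>i<CARD('q). cnj (slice_transform (z i) A $ a $ b) * slice_transform (z i) B $ a $ b) =
        (\<Sum>i<CARD('q). \<Sum>k = 1..?q. \<Sum>l = 1..?q.
          (cnj (z i powi (k - 1)) * z i powi (l - 1)) * of_real (x k * y l))"
      unfolding slice_transform_def vec_lambda_beta cnj_sum sum_product
      by (simp add: x_def y_def mult_ac)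
    also have "\<dots> = (\<Sum>i<CARD('q). \<Sum>k = 1..?q. \<Sum>l = 1..?q.
          (root1 TYPE('q) powi (l - k)) ^ i * of_real (x k * y l))"
      by (simp only: zz)
    also have "\<dots> = (\<Sum>k = 1..?q. \<Sum>i<CARD('q). \<Sum>l = 1..?q.
          (root1 TYPE('q) powi (l - k)) ^ i * of_real (x k * y l))"
      by (rule sum.swap)
    also have "\<dots> = (\<Sum>k = 1..?q. \<Sum>l = 1..?q. \<Sum>i<CARD('q).
          (root1 TYPE('q) powi (l - k)) ^ i * of_real (x k * y l))"
      by (intro sum.cong refl sum.swap)
    also have "\<dots> = (\<Sum>k = 1..?q. \<Sum>l = 1..?q.
          (if k = l then of_nat CARD('q) else 0) * of_real (x k * y l))"
      by (intro sum.cong refl) (simp only: sum_distrib_right[symmetric] sum_root1_powers)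
    also have "\<dots> = (\<Sum>k = 1..?q. of_nat CARD('q) * of_real (x k * y k))"
    proof (intro sum.cong refl)
      fix k assume "k \<in> {1..?q}"
      then show "(\<Sum>l = 1..?q. (if k = l then of_nat CARD('q) else 0) * of_real (x k * y l)) =
          (of_nat CARD('q) * of_real (x k * y k) :: complex)"
        by (subst sum.remove[of _ k]) (auto intro!: sum.neutral)
    qed
    finally show ?thesis
      by (simp add: x_def y_def sum_distrib_left)
  qed
  have "(\<Sum>i<CARD('q). \<Sum>a\<in>UNIV. \<Sum>b\<in>UNIV.
      cnj (slice_transform (z i) A $ a $ b) * slice_transform (z i) B $ a $ b) =
    (\<Sum>a\<in>UNIV. \<Sum>i<CARD('q). \<Sum>b\<in>UNIV.
      cnj (slice_transform (z i) A $ a $ b) * slice_transform (z i) B $ a $ b)"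
    by (rule sum.swap)
  also have "\<dots> = (\<Sum>a\<in>UNIV. \<Sum>b\<in>UNIV. \<Sum>i<CARD('q).
      cnj (slice_transform (z i) A $ a $ b) * slice_transform (z i) B $ a $ b)"
    by (intro sum.cong refl sum.swap)
  also have "\<dots> = of_real (CARD('q) *
      (\<Sum>a\<in>UNIV. \<Sum>b\<in>UNIV. \<Sum>k = 1..?q. frontal A k $ a $ b * frontal B k $ a $ b))"
    by (simp only: entry of_real_sum[symmetric] sum_distrib_left[symmetric])
  also have "(\<Sum>a\<in>UNIV. \<Sum>b\<in>UNIV. \<Sum>k = 1..?q. frontal A k $ a $ b * frontal B k $ a $ b) =
      (\<Sum>a\<in>UNIV. \<Sum>k = 1..?q. \<Sum>b\<in>UNIV. frontal A k $ a $ b * frontal B k $ a $ b)"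
    by (intro sum.cong refl sum.swap)
  also have "\<dots> = (\<Sum>k = 1..?q. \<Sum>a\<in>UNIV. \<Sum>b\<in>UNIV. frontal A k $ a $ b * frontal B k $ a $ b)"
    by (rule sum.swap)
  also have "\<dots> = A \<bullet> B"
    by (simp add: inner_tensor_frontal) (simp add: inner_vec_def)
  finally show ?thesis .
qed

lemma t_sym_pos_def_inner_pos:
  fixes C :: "real^'n^'n^'q::finite" and P :: "real^'l^'n^'q"
  assumes C: "t_sym_pos_def C" and "P \<noteq> 0"
  shows "0 < P \<bullet> (C \<star> P)"
proof -
  define z where "z i = root1 TYPE('q) ^ i" for i :: nat
  \<comment> \<open>The transformed \<open>C\<close> acts on each column \<open>b\<close> of the
    transformed \<open>P\<close> separately, so \<open>F i b\<close> is one Hermitian form per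
    frequency and column.\<close>
  define v where "v i b = (\<chi> a. slice_transform (z i) P $ a $ b)" for i b
  define F where "F i b = Re (\<Sum>a\<in>UNIV. cnj (v i b $ a) * (slice_transform (z i) C *v v i b) $ a)"
    for i b
  have F_pos: "0 < F i b" if "i < CARD('q)" "v i b \<noteq> 0" for i b
  proof -
    \<comment> \<open>Frequencies \<open>i\<close> start at 0, transformed slices at 1.\<close>
    have "hermitian_pos_def (dft_slice C (Suc i))"
      using C that(1) by (auto simp: t_sym_pos_def_def)
    then show ?thesis
      using that(2) by (simp add: hermitian_pos_def_def F_def dft_slice_eq_slice_transform z_def)
  qed
  have F_nonneg: "0 \<le> F i b" if "i < CARD('q)" for i b
    using F_pos[OF that, of b] by (cases "v i b = 0") (auto simp: F_def)
  have "z i ^ CARD('q) = 1" for i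
    by (metis z_def mult.commute power_mult power_one root1_power_CARD)
  then have "complex_of_real (CARD('q) * (P \<bullet> (C \<star> P))) =
      (\<Sum>i<CARD('q). \<Sum>a\<in>UNIV. \<Sum>b\<in>UNIV. cnj (v i b $ a) * (slice_transform (z i) C *v v i b) $ a)"
    unfolding parseval_slice_transform[symmetric]
    by (simp add: slice_transform_t_prod v_def z_def matrix_matrix_mult_def matrix_vector_mult_def)
  also have "\<dots> =
      (\<Sum>i<CARD('q). \<Sum>b\<in>UNIV. \<Sum>a\<in>UNIV. cnj (v i b $ a) * (slice_transform (z i) C *v v i b) $ a)"
    by (intro sum.cong refl sum.swap)
  finally have "Re (complex_of_real (CARD('q) * (P \<bullet> (C \<star> P)))) = (\<Sum>i<CARD('q). \<Sum>b\<in>UNIV. F i b)"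
    by (simp only: F_def Re_sum)
  then have eq: "CARD('q) * (P \<bullet> (C \<star> P)) = (\<Sum>i<CARD('q). \<Sum>b\<in>UNIV. F i b)"
    by simp
  \<comment> \<open>If every transformed column vanished, Parseval for \<open>P\<close> with itself
    would give \<open>P = 0\<close>.\<close>
  have "\<exists>i<CARD('q). \<exists>b. v i b \<noteq> 0"
  proof (rule ccontr)
    assume "\<not> ?thesis"
    then have "slice_transform (z i) P $ a $ b = 0" if "i < CARD('q)" for i a b
      using that by (auto simp: v_def vec_eq_iff)
    then have "complex_of_real (CARD('q) * (P \<bullet> P)) = 0"
      unfolding parseval_slice_transform[symmetric] z_def by simp
    then show False
      using \<open>P \<noteq> 0\<close> by simp
  qed
  then obtain i b where ib: "i < CARD('q)" "v i b \<noteq> 0"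
    by blast
  have "0 < (\<Sum>b\<in>UNIV. F i b)"
    using ib by (intro sum_pos2[of _ b] F_pos F_nonneg) auto
  then have "0 < (\<Sum>i<CARD('q). \<Sum>b\<in>UNIV. F i b)"
    using ib by (intro sum_pos2[of _ i] sum_nonneg F_nonneg) auto
  then show ?thesis
    unfolding eq[symmetric] by (simp add: zero_less_mult_iff)
qed

section \<open>Conjugate gradients\<close>

text \<open>Conjugate gradients in an arbitrary real inner product space. The induction runs over
  prefixes \<open>n\<close> of a fixed run of length \<open>m\<close>; the added invariant
  \<open>P t \<bullet> R t = R t \<bullet> R t\<close> keeps the step lengths nonzero.\<close>

lemma conjugate_gradient_orthogonality:
  fixes c :: "'a::real_inner \<Rightarrow> 'a" and R P :: "nat \<Rightarrow> 'a"
  assumes c_adj: "\<And>x y. c x \<bullet> y = x \<bullet> c y"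
    and c_pos: "\<And>x. x \<noteq> 0 \<Longrightarrow> 0 < x \<bullet> c x"
    and P1: "P 1 = R 1"
    and R_step: "\<And>k. \<lbrakk>1 \<le> k; k < m\<rbrakk> \<Longrightarrow>
      R (Suc k) = R k - ((P k \<bullet> R k) / (P k \<bullet> c (P k))) *\<^sub>R c (P k)"
    and P_step: "\<And>k. \<lbrakk>1 \<le> k; k < m\<rbrakk> \<Longrightarrow>
      P (Suc k) = R (Suc k) - ((c (P k) \<bullet> R (Suc k)) / (P k \<bullet> c (P k))) *\<^sub>R P k"
    and R_nz: "\<And>k. \<lbrakk>1 \<le> k; k \<le> m\<rbrakk> \<Longrightarrow> R k \<noteq> 0"
    and "n \<le> m"
  shows "(\<forall>t\<in>{1..n}. P t \<noteq> 0 \<and> P t \<bullet> R t = R t \<bullet> R t) \<and>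
    (\<forall>t\<in>{1..n}. \<forall>s\<in>{1..<t}. R s \<bullet> R t = 0 \<and> c (P s) \<bullet> P t = 0)"
  using \<open>n \<le> m\<close>
proof (induction n)
  case (Suc n)
  show ?case
  proof (cases "n = 0")
    case True
    then show ?thesis
      using P1 R_nz[of 1] Suc.prems by auto
  next
    case False
    then have n: "1 \<le> n" "n < m"
      using Suc.prems by auto
    have P_nz: "P t \<noteq> 0" and PR: "P t \<bullet> R t = R t \<bullet> R t" if "t \<in> {1..n}" for t
      using Suc that by auto
    have RR: "R s \<bullet> R t = 0" and cPP: "c (P s) \<bullet> P t = 0" if "t \<in> {1..n}" "s \<in> {1..<t}" for s t
      using Suc that by auto
    define \<alpha> where "\<alpha> k = (P k \<bullet> R k) / (P k \<bullet> c (P k))" for k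
    define \<beta> where "\<beta> k = (c (P k) \<bullet> R (Suc k)) / (P k \<bullet> c (P k))" for k
    have d_pos: "0 < P t \<bullet> c (P t)" if "t \<in> {1..n}" for t
      using c_pos P_nz that by blast
    have \<alpha>_nz: "\<alpha> t \<noteq> 0" if "t \<in> {1..n}" for t
      using that d_pos[OF that] PR[OF that] R_nz[of t] n by (auto simp: \<alpha>_def)
    have R_Suc: "R (Suc k) = R k - \<alpha> k *\<^sub>R c (P k)" and P_Suc: "P (Suc k) = R (Suc k) - \<beta> k *\<^sub>R P k"
      if "k \<in> {1..n}" for k
      using R_step[of k] P_step[of k] that n by (auto simp: \<alpha>_def \<beta>_def)
    \<comment> \<open>\<open>R s\<close> and \<open>P s\<close> differ by a multiple of
      \<open>P (s - 1)\<close>, which is already conjugate to \<open>P n\<close>; for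
      \<open>s = 1\<close> they coincide.\<close>
    have R_cP: "R s \<bullet> c (P n) = P s \<bullet> c (P n)" if "s \<in> {1..n}" for s
    proof (cases "s = 1")
      case False
      define r where "r = s - 1"
      have r: "s = Suc r" "r \<in> {1..n}" "r \<in> {1..<n}"
        using that False by (auto simp: r_def)
      have "R s = P s + \<beta> r *\<^sub>R P r" "P r \<bullet> c (P n) = 0"
        using P_Suc[of r] cPP[of n r] n r by (auto simp: c_adj)
      then show ?thesis
        by (simp add: inner_add_left)
    qed (simp add: P1[simplified])
    have \<alpha>d: "\<alpha> n * (P n \<bullet> c (P n)) = R n \<bullet> R n"
      using d_pos[of n] PR[of n] n by (auto simp: \<alpha>_def)
    \<comment> \<open>For \<open>s = n\<close> the step length \<open>\<alpha> n\<close> cancels the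
      two terms; for smaller \<open>s\<close> both vanish by induction.\<close>
    have RR': "R s \<bullet> R (Suc n) = 0" if "s \<in> {1..n}" for s
    proof (cases "s = n")
      case True
      then show ?thesis
        using R_Suc[of n] R_cP[of n] \<alpha>d n by (simp add: inner_diff_right)
    next
      case False
      then have "R s \<bullet> R n = 0" "c (P s) \<bullet> P n = 0"
        using RR[of n s] cPP[of n s] that n by auto
      then show ?thesis
        using R_Suc[of n] R_cP[OF that] n by (simp add: inner_diff_right c_adj)
    qed
    \<comment> \<open>Exact line search: the new residual is orthogonal to the direction just
      used.\<close>
    have "P n \<bullet> R (Suc n) = 0"
      using R_Suc[of n] \<alpha>d PR[of n] n by (simp add: inner_diff_right)
    then have PR': "P (Suc n) \<bullet> R (Suc n) = R (Suc n) \<bullet> R (Suc n)"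
      using P_Suc[of n] n by (simp add: inner_diff_left)
    then have P_nz': "P (Suc n) \<noteq> 0"
      using R_nz[of "Suc n"] n by auto
    have cPP': "c (P s) \<bullet> P (Suc n) = 0" if s: "s \<in> {1..n}" for s
    proof (cases "s = n")
      \<comment> \<open>\<open>\<beta> n\<close> is chosen to remove exactly this component.\<close>
      case True
      then show ?thesis
        using P_Suc[of n] d_pos[of n] n by (simp add: \<beta>_def inner_diff_right c_adj)
    next
      case False
      \<comment> \<open>\<open>c (P s)\<close> is a multiple of a difference of consecutive
        residuals. As \<open>s < n\<close>, both are orthogonal to \<open>R (Suc n)\<close>.\<close>
      have "\<alpha> s *\<^sub>R c (P s) = R s - R (Suc s)"
        using R_Suc[OF s] by simp
      then have "\<alpha> s * (c (P s) \<bullet> R (Suc n)) = R s \<bullet> R (Suc n) - R (Suc s) \<bullet> R (Suc n)"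
        by (metis inner_diff_left inner_scaleR_left)
      also have "\<dots> = 0"
        using RR'[of s] RR'[of "Suc s"] s False by auto
      finally have "c (P s) \<bullet> R (Suc n) = 0"
        using \<alpha>_nz[OF s] by simp
      then show ?thesis
        using P_Suc[of n] cPP[of n s] s False n by (simp add: inner_diff_right)
    qed
    show ?thesis
      using P_nz PR RR cPP RR' PR' P_nz' cPP' by (auto simp: le_Suc_eq less_Suc_eq_le)
  qed
qed simp

section \<open>Algorithm A as a conjugate gradient iteration\<close>

theorem theorem3p4:
  fixes C :: "real^'n^'n^'q::finite"
    and D X1 :: "real^'l^'n^'q"
    and X R P :: "nat \<Rightarrow> real^'l^'n^'q"
    and m :: nat
  assumes "t_sym_pos_def C"
    and "algorithm_A C D X1 m X R P"
    and "\<forall>k \<in> {1..m}. R k \<noteq> 0"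
  shows "orthogonal_tensors m R \<and> C_orthogonal_tensors C m P"
proof -
  have sym: "t_transpose C = C"
    using assms(1) by (simp add: t_sym_pos_def_def)
  have adj: "(C \<star> A) \<bullet> B = A \<bullet> (C \<star> B)" for A B :: "real^'l^'n^'q"
    using inner_t_prod[of C A B] sym by simp
  \<comment> \<open>The product associates to the left, and symmetry of \<open>C\<close> makes
    \<open>t_transpose A \<star> C\<close> the transpose of \<open>C \<star> A\<close>.\<close>
  have tr: "trace1 (t_transpose A \<star> C \<star> B) = (C \<star> A) \<bullet> B" for A B :: "real^'l^'n^'q"
    using trace1_t_transpose_t_prod[of "C \<star> A" B] by (simp add: t_transpose_t_prod sym)
  have R_step: "R (Suc k) = R k - ((P k \<bullet> R k) / (P k \<bullet> (C \<star> P k))) *\<^sub>R (C \<star> P k)"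
    and P_step: "P (Suc k) = R (Suc k) - (((C \<star> P k) \<bullet> R (Suc k)) / (P k \<bullet> (C \<star> P k))) *\<^sub>R P k"
    if "1 \<le> k" "k < m" for k
  proof -
    have step: "Suc k \<in> {2..m}"
      using that by auto
    have Rk: "R k = D - C \<star> X k"
      using assms(2) that by (cases "k = 1") (auto simp: algorithm_A_def)
    have "X (Suc k) = X k + ((P k \<bullet> R k) / (P k \<bullet> (C \<star> P k))) *\<^sub>R P k"
      "R (Suc k) = D - C \<star> X (Suc k)"
      using assms(2) step by (auto simp: algorithm_A_def trace1_t_transpose_t_prod tr adj)
    \<comment> \<open>Linearity turns the directly computed residual into the recursive
      update.\<close>
    then show "R (Suc k) = R k - ((P k \<bullet> R k) / (P k \<bullet> (C \<star> P k))) *\<^sub>R (C \<star> P k)"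
      by (simp add: Rk linear_add[OF linear_t_prod] linear_scale[OF linear_t_prod])
    show "P (Suc k) = R (Suc k) - (((C \<star> P k) \<bullet> R (Suc k)) / (P k \<bullet> (C \<star> P k))) *\<^sub>R P k"
      using assms(2) step by (auto simp: algorithm_A_def tr adj)
  qed
  have P1: "P 1 = R 1"
    using assms(2) by (simp add: algorithm_A_def)
  have *: "(\<forall>t\<in>{1..m}. P t \<noteq> 0 \<and> P t \<bullet> R t = R t \<bullet> R t) \<and>
      (\<forall>t\<in>{1..m}. \<forall>s\<in>{1..<t}. R s \<bullet> R t = 0 \<and> (C \<star> P s) \<bullet> P t = 0)"
    using assms(3)
    by (intro conjugate_gradient_orthogonality[where c = "(\<star>) C" and m = m]
        adj t_sym_pos_def_inner_pos assms(1) P1 R_step P_step) auto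
  \<comment> \<open>The induction covers \<open>s < t\<close>; self-adjointness of \<open>C\<close>
    and symmetry of the inner product give the other order.\<close>
  have "R s \<bullet> R t = 0 \<and> (C \<star> P s) \<bullet> P t = 0" if "s \<in> {1..m}" "t \<in> {1..m}" "s \<noteq> t" for s t
  proof (cases "s < t")
    case True
    then show ?thesis
      using * that by auto
  next
    case False
    then have "R t \<bullet> R s = 0 \<and> (C \<star> P t) \<bullet> P s = 0"
      using * that by auto
    then show ?thesis
      by (metis adj inner_commute)
  qed
  then show ?thesis
    using * assms(3) by (auto simp: orthogonal_tensors_def C_orthogonal_tensors_def)
qed

end
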